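(* Let $(X,T)$ be a topological dynamical system. Then $(X,T)$ is mean sensitive if and only if it is sensitive in the mean.
   Context: A topological dynamical system $(X,T)$ consists of a nonempty compact metric space $X$ with metric $d$ and a continuous map $T:X\to X$. $(X,T)$ is mean sensitive if there exists $\delta>0$ such that for any nonempty open subset $U$ of $X$ there exist $x,y\in U$ with $\limsup_{n\to\infty}\frac1n\sum_{k=1}^n d(T^kx,T^ky)>\delta$. $(X,T)$ is sensitive in the mean if there exists $\delta>0$ such that for any nonempty open subset $U$ of $X$ there exist an integer $n\ge1$ and $x,y\in U$ with $\frac1n\sum_{k=1}^n d(T^kx,T^ky)>\delta$. *)

theory Defs
  imports "HOL-Analysis.Analysis"
begin

locale topological_dynamical_system =
  fixes X :: "'a::metric_space set" and T :: "'a \<Rightarrow> 'a"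
  assumes nonempty: "X \<noteq> {}"
    and compact: "compact X"
    and continuous: "continuous_on X T"
    and maps_into: "T ` X \<subseteq> X"

definition mean_dist :: "('a::metric_space \<Rightarrow> 'a) \<Rightarrow> nat \<Rightarrow> 'a \<Rightarrow> 'a \<Rightarrow> real"
  where "mean_dist T n x y = (1 / real n) * (\<Sum>k=1..n. dist ((T ^^ k) x) ((T ^^ k) y))"

text \<open>Nonempty open subsets of the space are taken in the subspace topology of \<open>X\<close>.
  The limit superior is formed in the extended reals, since type \<open>real\<close> is not a complete
  lattice; the value of \<open>mean_dist T 0\<close> does not affect it.\<close>

definition mean_sensitive :: "'a::metric_space set \<Rightarrow> ('a \<Rightarrow> 'a) \<Rightarrow> bool"
  where "mean_sensitive X T \<longleftrightarrow>
    (\<exists>\<delta>::real. \<delta> > 0 \<and>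
      (\<forall>U. openin (top_of_set X) U \<and> U \<noteq> {} \<longrightarrow>
        (\<exists>x\<in>U. \<exists>y\<in>U. limsup (\<lambda>n. ereal (mean_dist T n x y)) > ereal \<delta>)))"

definition sensitive_in_the_mean :: "'a::metric_space set \<Rightarrow> ('a \<Rightarrow> 'a) \<Rightarrow> bool"
  where "sensitive_in_the_mean X T \<longleftrightarrow>
    (\<exists>\<delta>::real. \<delta> > 0 \<and>
      (\<forall>U. openin (top_of_set X) U \<and> U \<noteq> {} \<longrightarrow>
        (\<exists>n\<ge>1. \<exists>x\<in>U. \<exists>y\<in>U. mean_dist T n x y > \<delta>)))"

end

theory Submission
  imports Defs
begin

text \<open>
  Mean sensitivity trivially gives sensitivity in the mean: a limit superior above \<open>\<delta>\<close> forces
  some average to exceed \<open>\<delta>\<close>.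

  The converse rests on two observations about the averages \<open>mean_dist T n\<close>, each of which is a
  continuous pseudometric on \<open>X\<close>.  First, sensitivity in the mean with constant \<open>\<delta>\<close> is always
  witnessed at arbitrarily late times: since the finitely many averages with \<open>n < N\<close> are continuous
  and vanish on the diagonal, a sufficiently small open piece of \<open>U\<close> has diameter below \<open>\<delta>\<close> with
  respect to all of them (\<open>mean_separation_at_late_times\<close>).  Secondly, by the Baire category
  theorem, if the limit superior of the averages stays below \<open>c\<close> for all pairs in an open set, then
  on a smaller open set this bound becomes uniform in the time from which it holds, at the
  cost of a factor of two (\<open>uniform_mean_bound\<close>).  With \<open>c = \<delta> / 2\<close> the
  two are contradictory, so \<open>\<delta> / 4\<close> is a constant of mean sensitivity.
\<close>

lemma mean_dist_commute: "mean_dist T n x y = mean_dist T n y x"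
  by (simp add: mean_dist_def dist_commute)

lemma mean_dist_self: "mean_dist T n x x = 0"
  by (simp add: mean_dist_def)

lemma mean_dist_triangle: "mean_dist T n x z \<le> mean_dist T n x y + mean_dist T n y z"
proof -
  have "(\<Sum>k=1..n. dist ((T ^^ k) x) ((T ^^ k) z))
    \<le> (\<Sum>k=1..n. dist ((T ^^ k) x) ((T ^^ k) y) + dist ((T ^^ k) y) ((T ^^ k) z))"
    by (intro sum_mono dist_triangle)
  then show ?thesis
    by (simp add: mean_dist_def sum.distrib divide_right_mono flip: add_divide_distrib)
qed

lemma (in topological_dynamical_system) iterate_in_space: "x \<in> X \<Longrightarrow> (T ^^ k) x \<in> X"
  using maps_into by (induction k) auto

lemma (in topological_dynamical_system) continuous_on_iterate: "continuous_on X (T ^^ k)"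
proof (induction k)
  case (Suc k)
  have "(T ^^ k) ` X \<subseteq> X"
    using iterate_in_space by blast
  then have "continuous_on ((T ^^ k) ` X) T"
    using continuous continuous_on_subset by blast
  then show ?case
    using Suc continuous_on_compose by fastforce
qed (simp add: id_def)

lemma (in topological_dynamical_system) continuous_on_mean_dist:
  "continuous_on X (mean_dist T n x)"
  unfolding mean_dist_def by (intro continuous_intros continuous_on_iterate)

text \<open>A relatively open subset of a compact space need not be compact, but it is still locally
  compact, so the category theorem applies to it.\<close>

lemma Baire_closed_cover_open_subset_compact:
  fixes X :: "'a::metric_space set" and F :: "nat \<Rightarrow> 'a set"
  assumes "compact X" and U: "openin (top_of_set X) U" "U \<noteq> {}"
    and closed: "\<And>N. closedin (top_of_set U) (F N)"
    and cover: "U \<subseteq> (\<Union>N. F N)"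
  obtains N V where "openin (top_of_set X) V" "V \<noteq> {}" "V \<subseteq> U" "V \<subseteq> F N"
proof -
  have "U \<subseteq> X"
    using U openin_imp_subset by blast
  have "locally_compact_space (top_of_set X)"
    using \<open>compact X\<close> by (simp add: compact_imp_locally_compact_space compact_space_subtopology)
  then have "locally_compact_space (subtopology (top_of_set X) U)"
    using U(1) Hausdorff_space_subtopology[OF Hausdorff_space_euclidean]
      locally_compact_space_open_subset by blast
  then have lc: "locally_compact_space (top_of_set U)"
    using \<open>U \<subseteq> X\<close> by (simp add: subtopology_subtopology inf.absorb2)
  have reg: "regular_space (top_of_set U)"
    by (simp add: regular_space_euclidean regular_space_subtopology)
  have "(\<Union>N. F N) = U"
    using closed cover closedin_imp_subset by blast
  then have "top_of_set U interior_of (\<Union>(range F)) \<noteq> {}"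
    using U interior_of_topspace[of "top_of_set U"] by simp
  moreover have "top_of_set U interior_of (\<Union>(range F)) = {}"
    if "\<forall>N. top_of_set U interior_of F N = {}"
    using that lc reg closed by (intro Baire_category_alt) auto
  ultimately obtain N where "top_of_set U interior_of F N \<noteq> {}"
    by blast
  moreover have "openin (top_of_set X) (top_of_set U interior_of F N)"
    using U openin_trans openin_interior_of by blast
  moreover have "top_of_set U interior_of F N \<subseteq> F N"
    by (rule interior_of_subset)
  moreover have "F N \<subseteq> U"
    using closed closedin_imp_subset by blast
  ultimately show ?thesis
    using that by blast
qed

text \<open>The averages before time \<open>N\<close> are made harmless by shrinking \<open>U\<close> to a neighbourhood of one of
  its points \<open>x\<close> on which they are all below \<open>\<delta> / 2\<close> from \<open>x\<close>; the separation that sensitivity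
  provides in this neighbourhood must then happen later.\<close>

lemma (in topological_dynamical_system) mean_separation_at_late_times:
  assumes "\<delta> > 0"
    and sens: "\<And>U. openin (top_of_set X) U \<Longrightarrow> U \<noteq> {} \<Longrightarrow>
      \<exists>n\<ge>1. \<exists>x\<in>U. \<exists>y\<in>U. mean_dist T n x y > \<delta>"
    and U: "openin (top_of_set X) U" "U \<noteq> {}"
  obtains n x y where "n \<ge> N" "x \<in> U" "y \<in> U" "mean_dist T n x y > \<delta>"
proof -
  obtain x where "x \<in> U"
    using U by blast
  \<comment> \<open>The index \<open>n = N\<close> is included only to make the family nonempty, so that its intersection
    lies in \<open>X\<close> even for \<open>N = 0\<close>.\<close>
  define W where "W = U \<inter> (\<Inter>n\<le>N. X \<inter> mean_dist T n x -` {..<\<delta> / 2})"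
  have "openin (top_of_set X) (X \<inter> mean_dist T n x -` {..<\<delta> / 2})" for n
    by (intro continuous_openin_preimage_gen continuous_on_mean_dist open_lessThan)
  then have "openin (top_of_set X) (\<Inter>n\<le>N. X \<inter> mean_dist T n x -` {..<\<delta> / 2})"
    by (rule openin_INT2[rotated 2]) auto
  then have "openin (top_of_set X) W"
    unfolding W_def by (rule openin_Int[OF U(1)])
  moreover have "x \<in> W"
    using \<open>x \<in> U\<close> \<open>\<delta> > 0\<close> openin_imp_subset[OF U(1)] by (auto simp: W_def mean_dist_self)
  ultimately obtain n y z where n: "y \<in> W" "z \<in> W" "mean_dist T n y z > \<delta>"
    using sens[of W] by blast
  have "n \<ge> N"
  proof (rule ccontr)
    assume "\<not> n \<ge> N"
    then have "mean_dist T n x y < \<delta> / 2" "mean_dist T n x z < \<delta> / 2"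
      using n by (auto simp: W_def)
    with mean_dist_triangle[of T n y z x] n(3) show False
      by (simp add: mean_dist_commute[of T n y x])
  qed
  then show ?thesis
    using that n by (auto simp: W_def)
qed

text \<open>Comparing all points with a single base point \<open>x\<close> allows the category argument to take place
  in \<open>U\<close> rather than in \<open>U \<times> U\<close>: the points whose averages from \<open>x\<close> are at most \<open>c\<close> from time
  \<open>N\<close> on form a relatively closed set, these sets cover \<open>U\<close> as \<open>N\<close> varies, and so one of them
  has interior.  Returning to arbitrary pairs through \<open>x\<close> doubles the bound.\<close>

lemma (in topological_dynamical_system) uniform_mean_bound:
  assumes U: "openin (top_of_set X) U" "U \<noteq> {}"
    and bound: "\<And>x y. x \<in> U \<Longrightarrow> y \<in> U \<Longrightarrow> limsup (\<lambda>n. ereal (mean_dist T n x y)) < ereal c"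
  obtains N V where "openin (top_of_set X) V" "V \<noteq> {}" "V \<subseteq> U"
    "\<forall>n\<ge>N. \<forall>y\<in>V. \<forall>z\<in>V. mean_dist T n y z \<le> 2 * c"
proof -
  obtain x where "x \<in> U"
    using U by blast
  define F where "F N = (\<Inter>n\<in>{N..}. U \<inter> mean_dist T n x -` {..c})" for N
  have "continuous_on U (mean_dist T n x)" for n
    using continuous_on_mean_dist continuous_on_subset openin_imp_subset[OF U(1)] by blast
  then have "closedin (top_of_set U) (U \<inter> mean_dist T n x -` {..c})" for n
    by (intro continuous_closedin_preimage closed_atMost)
  then have closed: "closedin (top_of_set U) (F N)" for N
    unfolding F_def by (intro closedin_INT) auto
  have cover: "U \<subseteq> (\<Union>N. F N)"
  proof
    fix y assume "y \<in> U"
    then have "\<forall>\<^sub>F n in sequentially. ereal (mean_dist T n x y) < ereal c"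
      using bound \<open>x \<in> U\<close> by (intro Limsup_lessD)
    then obtain N where "\<forall>n\<ge>N. mean_dist T n x y < c"
      by (auto simp: eventually_sequentially)
    then show "y \<in> (\<Union>N. F N)"
      using \<open>y \<in> U\<close> by (force simp: F_def)
  qed
  obtain N V where V: "openin (top_of_set X) V" "V \<noteq> {}" "V \<subseteq> U" "V \<subseteq> F N"
    using Baire_closed_cover_open_subset_compact[OF compact U closed cover] .
  have "mean_dist T n y z \<le> 2 * c" if "n \<ge> N" "y \<in> V" "z \<in> V" for n y z
  proof -
    have "mean_dist T n x y \<le> c" "mean_dist T n x z \<le> c"
      using that V(4) by (auto simp: F_def)
    with mean_dist_triangle[of T n y z x] show ?thesis
      by (simp add: mean_dist_commute[of T n y x])
  qed
  with V that show ?thesis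
    by blast
qed

lemma mean_sensitive_imp_sensitive_in_the_mean:
  assumes "mean_sensitive X T"
  shows "sensitive_in_the_mean X T"
proof -
  have "\<exists>n\<ge>1. mean_dist T n x y > \<delta>"
    if "limsup (\<lambda>n. ereal (mean_dist T n x y)) > ereal \<delta>" for x y \<delta>
  proof (rule ccontr)
    assume "\<not> (\<exists>n\<ge>1. mean_dist T n x y > \<delta>)"
    then have "\<forall>\<^sub>F n in sequentially. ereal (mean_dist T n x y) \<le> ereal \<delta>"
      by (intro eventually_sequentiallyI[of 1]) (simp add: not_less)
    then have "limsup (\<lambda>n. ereal (mean_dist T n x y)) \<le> ereal \<delta>"
      by (rule Limsup_bounded)
    with that show False
      by simp
  qed
  with assms show ?thesis
    unfolding mean_sensitive_def sensitive_in_the_mean_def by meson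
qed

lemma (in topological_dynamical_system) sensitive_in_the_mean_imp_mean_sensitive:
  assumes "sensitive_in_the_mean X T"
  shows "mean_sensitive X T"
proof -
  obtain \<delta> where "\<delta> > 0" and "\<forall>U. openin (top_of_set X) U \<and> U \<noteq> {} \<longrightarrow>
      (\<exists>n\<ge>1. \<exists>x\<in>U. \<exists>y\<in>U. mean_dist T n x y > \<delta>)"
    using assms unfolding sensitive_in_the_mean_def by (elim exE conjE)
  then have sens: "\<exists>n\<ge>1. \<exists>x\<in>U. \<exists>y\<in>U. mean_dist T n x y > \<delta>"
    if "openin (top_of_set X) U" "U \<noteq> {}" for U
    using that by simp
  have "\<exists>x\<in>U. \<exists>y\<in>U. limsup (\<lambda>n. ereal (mean_dist T n x y)) > ereal (\<delta> / 4)"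
    if U: "openin (top_of_set X) U" "U \<noteq> {}" for U
  proof (rule ccontr)
    assume "\<not> ?thesis"
    then have le: "limsup (\<lambda>n. ereal (mean_dist T n x y)) \<le> ereal (\<delta> / 4)"
      if "x \<in> U" "y \<in> U" for x y
      using that by (auto simp: not_less)
    have "ereal (\<delta> / 4) < ereal (\<delta> / 2)"
      using \<open>\<delta> > 0\<close> by simp
    then have less: "limsup (\<lambda>n. ereal (mean_dist T n x y)) < ereal (\<delta> / 2)"
      if "x \<in> U" "y \<in> U" for x y
      using le[OF that] by (rule le_less_trans[rotated])
    obtain N V where V: "openin (top_of_set X) V" "V \<noteq> {}" "V \<subseteq> U"
      "\<forall>n\<ge>N. \<forall>y\<in>V. \<forall>z\<in>V. mean_dist T n y z \<le> 2 * (\<delta> / 2)"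
      using uniform_mean_bound[OF U less] .
    obtain n y z where "n \<ge> N" "y \<in> V" "z \<in> V" "mean_dist T n y z > \<delta>"
      using mean_separation_at_late_times[OF \<open>\<delta> > 0\<close> sens V(1,2)] .
    with V(4) show False
      by fastforce
  qed
  moreover have "\<delta> / 4 > 0"
    using \<open>\<delta> > 0\<close> by simp
  ultimately show ?thesis
    unfolding mean_sensitive_def by blast
qed

theorem theorem1:
  fixes X :: "'a::metric_space set" and T :: "'a \<Rightarrow> 'a"
  assumes "topological_dynamical_system X T"
  shows "mean_sensitive X T \<longleftrightarrow> sensitive_in_the_mean X T"
  using mean_sensitive_imp_sensitive_in_the_mean
    topological_dynamical_system.sensitive_in_the_mean_imp_mean_sensitive[OF assms]
  by blast

end
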